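(* Let $c,s$ be positive integers. If $G$ is a finite simple graph that is $(c,s)$-normal, then $|V(G)|\leq 2^{c+s}$. Equivalently, $N(c,s)\leq 2^{c+s}$.
   Context: A normal cover of a graph $G$ is a pair $(\mathcal C,\mathcal S)$ where $\mathcal C$ is a set of cliques of $G$ covering every vertex of $G$, $\mathcal S$ is a set of stable (independent) sets of $G$ covering every vertex of $G$, and every clique in $\mathcal C$ and every stable set in $\mathcal S$ have a vertex in common. For positive integers $c,s$, a $(c,s)$-normal cover is a normal cover in which every clique of $\mathcal C$ has at most $c$ vertices and every stable set of $\mathcal S$ has at most $s$ vertices; $G$ is $(c,s)$-normal if it admits a $(c,s)$-normal cover. $N(c,s)$ denotes the maximum number of vertices of a $(c,s)$-normal graph. *)

theory Defs
  imports "HOL-Library.Ramsey"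
begin

text \<open>
  Graphs are pairs of a vertex set \<open>V\<close> and a set \<open>E\<close> of two-element subsets of \<open>V\<close>, so that
  \<^const>\<open>clique\<close> and \<^const>\<open>indep\<close> from the Ramsey theory are applicable.
\<close>

definition finite_simple_graph :: "'a set \<Rightarrow> 'a set set \<Rightarrow> bool" where
  "finite_simple_graph V E \<longleftrightarrow> finite V \<and> E \<subseteq> [V]\<^bsup>2\<^esup>"

definition normal_cover :: "'a set \<Rightarrow> 'a set set \<Rightarrow> 'a set set \<Rightarrow> 'a set set \<Rightarrow> bool" where
  "normal_cover V E \<C> \<S> \<longleftrightarrow>
     (\<forall>K\<in>\<C>. K \<subseteq> V \<and> clique K E) \<and> \<Union>\<C> = V \<and>
     (\<forall>S\<in>\<S>. S \<subseteq> V \<and> indep S E) \<and> \<Union>\<S> = V \<and>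
     (\<forall>K\<in>\<C>. \<forall>S\<in>\<S>. K \<inter> S \<noteq> {})"

definition cs_normal_cover ::
    "nat \<Rightarrow> nat \<Rightarrow> 'a set \<Rightarrow> 'a set set \<Rightarrow> 'a set set \<Rightarrow> 'a set set \<Rightarrow> bool" where
  "cs_normal_cover c s V E \<C> \<S> \<longleftrightarrow>
     normal_cover V E \<C> \<S> \<and>
     (\<forall>K\<in>\<C>. finite K \<and> card K \<le> c) \<and> (\<forall>S\<in>\<S>. finite S \<and> card S \<le> s)"

definition cs_normal :: "nat \<Rightarrow> nat \<Rightarrow> 'a set \<Rightarrow> 'a set set \<Rightarrow> bool" where
  "cs_normal c s V E \<longleftrightarrow> (\<exists>\<C> \<S>. cs_normal_cover c s V E \<C> \<S>)"

text \<open>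
  Vertices may be taken to be natural numbers: by \<open>cs_normal_card_in_orders\<close> below, graphs over
  other vertex types do not contribute any further orders.
\<close>

definition cs_normal_orders :: "nat \<Rightarrow> nat \<Rightarrow> nat set" where
  "cs_normal_orders c s =
     {card V | (V :: nat set) E. finite_simple_graph V E \<and> cs_normal c s V E}"

definition max_cs_normal :: "nat \<Rightarrow> nat \<Rightarrow> nat" where
  "max_cs_normal c s = Max (cs_normal_orders c s)"

lemma zero_in_cs_normal_orders: "0 \<in> cs_normal_orders c s"
proof -
  have "cs_normal_cover c s ({} :: nat set) {} {} {}"
    by (simp add: cs_normal_cover_def normal_cover_def)
  then have "finite_simple_graph ({} :: nat set) {} \<and> cs_normal c s ({} :: nat set) {}"
    by (auto simp: finite_simple_graph_def cs_normal_def)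
  then show ?thesis
    unfolding cs_normal_orders_def by (metis (mono_tags, lifting) card.empty mem_Collect_eq)
qed

lemma cs_normal_card_in_orders:
  fixes V :: "'a set"
  assumes G: "finite_simple_graph V E" and N: "cs_normal c s V E"
  shows "card V \<in> cs_normal_orders c s"
proof -
  from G have fin: "finite V" and E: "E \<subseteq> [V]\<^bsup>2\<^esup>"
    by (auto simp: finite_simple_graph_def)
  from fin obtain f :: "'a \<Rightarrow> nat" where f: "inj_on f V"
    using finite_imp_inj_to_nat_seg[OF fin] by auto
  from N obtain \<C> \<S> where nc: "cs_normal_cover c s V E \<C> \<S>"
    by (auto simp: cs_normal_def)
  let ?E = "(`) f ` E"
  have EV: "e \<subseteq> V" if "e \<in> E" for e
    using E that by (auto simp: nsets_def)
  have edge: "{f v, f w} \<in> ?E \<longleftrightarrow> {v, w} \<in> E" if "v \<in> V" "w \<in> V" for v w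
  proof
    assume "{f v, f w} \<in> ?E"
    then obtain e where e: "e \<in> E" "f ` e = f ` {v, w}" by auto
    then have "e = {v, w}"
      using inj_on_image_eq_iff[OF f EV[OF e(1)], of "{v, w}"] that by simp
    with e show "{v, w} \<in> E" by simp
  next
    assume "{v, w} \<in> E"
    then have "f ` {v, w} \<in> ?E" by blast
    then show "{f v, f w} \<in> ?E" by simp
  qed
  have cl: "clique (f ` K) ?E" if "K \<subseteq> V" "clique K E" for K
    unfolding clique_def
  proof (intro ballI impI)
    fix x y assume "x \<in> f ` K" "y \<in> f ` K" "x \<noteq> y"
    then obtain v w where "v \<in> K" "w \<in> K" "x = f v" "y = f w" "v \<noteq> w" by blast
    with that edge[of v w] show "{x, y} \<in> ?E" by (auto simp: clique_def subset_iff)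
  qed
  have ind: "indep (f ` K) ?E" if "K \<subseteq> V" "indep K E" for K
    unfolding indep_def
  proof (intro ballI impI)
    fix x y assume "x \<in> f ` K" "y \<in> f ` K" "x \<noteq> y"
    then obtain v w where "v \<in> K" "w \<in> K" "x = f v" "y = f w" "v \<noteq> w" by blast
    with that edge[of v w] show "{x, y} \<notin> ?E" by (auto simp: indep_def subset_iff)
  qed
  have "?E \<subseteq> [f ` V]\<^bsup>2\<^esup>"
  proof
    fix x assume "x \<in> ?E"
    then obtain e where e: "e \<in> E" "x = f ` e" by blast
    then have "card x = 2" "finite x" "x \<subseteq> f ` V"
      using E EV[OF e(1)] card_image[OF inj_on_subset[OF f EV[OF e(1)]]]
      by (auto simp: nsets_def)
    then show "x \<in> [f ` V]\<^bsup>2\<^esup>" by (simp add: nsets_def)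
  qed
  with fin have G': "finite_simple_graph (f ` V) ?E"
    by (simp add: finite_simple_graph_def)
  from nc have
      C: "\<And>K. K \<in> \<C> \<Longrightarrow> K \<subseteq> V \<and> clique K E \<and> finite K \<and> card K \<le> c" and
      S: "\<And>S. S \<in> \<S> \<Longrightarrow> S \<subseteq> V \<and> indep S E \<and> finite S \<and> card S \<le> s" and
      UC: "\<Union>\<C> = V" and US: "\<Union>\<S> = V" and
      meet: "\<And>K S. K \<in> \<C> \<Longrightarrow> S \<in> \<S> \<Longrightarrow> K \<inter> S \<noteq> {}"
    unfolding cs_normal_cover_def normal_cover_def by simp_all
  have "normal_cover (f ` V) ?E ((`) f ` \<C>) ((`) f ` \<S>)"
    unfolding normal_cover_def
  proof (intro conjI ballI)
    fix K assume "K \<in> (`) f ` \<C>"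
    then obtain L where L: "L \<in> \<C>" "K = f ` L" by (rule imageE)
    show "K \<subseteq> f ` V" using C[OF L(1)] L(2) by (simp add: image_mono)
    show "clique K ?E" using C[OF L(1)] L(2) cl by simp
    fix S assume "S \<in> (`) f ` \<S>"
    then obtain T where T: "T \<in> \<S>" "S = f ` T" by (rule imageE)
    from meet[OF L(1) T(1)] obtain x where "x \<in> L" "x \<in> T" by blast
    with L T have "f x \<in> K \<inter> S" by simp
    then show "K \<inter> S \<noteq> {}" by blast
  next
    fix S assume "S \<in> (`) f ` \<S>"
    then obtain T where T: "T \<in> \<S>" "S = f ` T" by (rule imageE)
    show "S \<subseteq> f ` V" using S[OF T(1)] T(2) by (simp add: image_mono)
    show "indep S ?E" using S[OF T(1)] T(2) ind by simp
  next
    show "\<Union>((`) f ` \<C>) = f ` V" "\<Union>((`) f ` \<S>) = f ` V"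
      using UC US by (simp_all only: image_Union[symmetric])
  qed
  moreover have "finite K \<and> card K \<le> c" if K: "K \<in> (`) f ` \<C>" for K
  proof -
    from K obtain L where L: "L \<in> \<C>" "K = f ` L" by (rule imageE)
    with C[OF L(1)] card_image_le[of L f] show ?thesis by simp
  qed
  moreover have "finite S \<and> card S \<le> s" if "S \<in> (`) f ` \<S>" for S
  proof -
    from that obtain T where T: "T \<in> \<S>" "S = f ` T" by (rule imageE)
    with S[OF T(1)] card_image_le[of T f] show ?thesis by simp
  qed
  ultimately have "cs_normal_cover c s (f ` V) ?E ((`) f ` \<C>) ((`) f ` \<S>)"
    unfolding cs_normal_cover_def by blast
  then have "cs_normal c s (f ` V) ?E"
    unfolding cs_normal_def by blast
  moreover have "card V = card (f ` V)"
    using f by (simp add: card_image)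
  ultimately show ?thesis
    using G' unfolding cs_normal_orders_def by blast
qed

end

theory Submission
  imports Defs Complex_Main
begin

text \<open>
  Assign to each vertex \<open>v\<close> a clique \<open>A v\<close> and a stable set \<open>B v\<close> of the cover that contain it, and
  give \<open>v\<close> the weight \<open>2^(-|B v|)\<close>. Let \<open>H\<close> be a smallest of the stable sets, and colour its vertices
  red or blue uniformly at random. Keep the vertices \<open>v\<close> outside \<open>H\<close> for which \<open>A v\<close> has no blue and
  \<open>B v\<close> no red vertex, and delete \<open>H\<close> from their cliques and stable sets: the cliques and stable
  sets that remain still meet in exactly one vertex, and every clique has lost exactly one vertex.
  A vertex outside \<open>H\<close> is kept with probability \<open>2^(-1 - |B v \<inter> H|)\<close>, so its expected new weight is half of
  its old weight, while \<open>H\<close> itself weighs at most \<open>|H| 2^(-|H|) \<le> 1/2\<close>. Hence the largest total weight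
  \<open>F k\<close> for cliques of size at most \<open>k\<close> satisfies \<open>F (k + 1) \<le> 1/2 + 2 F k\<close>, which gives
  \<open>F k \<le> (2^k - 1)/2\<close> and even \<open>|V| \<le> 2^s (2^c - 1)/2\<close>.
\<close>

lemma two_mult_le_power_two: "2 * m \<le> 2 ^ m" for m :: nat
proof (induction m)
  case (Suc m)
  then show ?case by (cases m) auto
qed simp

text \<open>Counts the colourings under which a vertex survives: such an \<open>R\<close> is
  determined by its free part, an arbitrary subset of \<open>H - {x} - T\<close>.\<close>

lemma card_subsets_between:
  assumes "finite H" "x \<in> H" "x \<notin> T"
  shows "card {R \<in> Pow H. x \<in> R \<and> T \<inter> R = {}} = 2 ^ (card H - 1 - card (T \<inter> H))"
proof -
  have eq: "{R \<in> Pow H. x \<in> R \<and> T \<inter> R = {}} = insert x ` Pow (H - {x} - T \<inter> H)" (is "?L = ?R")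
  proof
    show "?L \<subseteq> ?R"
    proof
      fix R assume "R \<in> ?L"
      then have "R = insert x (R - {x})" "R - {x} \<in> Pow (H - {x} - T \<inter> H)" by auto
      then show "R \<in> ?R" by (rule image_eqI)
    qed
    show "?R \<subseteq> ?L" using assms by auto
  qed
  have "inj_on (insert x) (Pow (H - {x} - T \<inter> H))"
    by (rule inj_onI, subst (asm) insert_ident) auto
  moreover have "card (H - {x} - T \<inter> H) = card H - 1 - card (T \<inter> H)"
    using assms by (subst card_Diff_subset) auto
  ultimately show ?thesis
    using assms unfolding eq by (simp add: card_image card_Pow)
qed

text \<open>No graph appears and \<open>A v\<close>, \<open>B v\<close> need not lie inside
  \<open>V\<close>: after the deletion of \<open>H\<close> they may still contain vertices that were
  not kept, so the induction needs this generality.\<close>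

lemma cross_intersecting_weight_le:
  fixes V :: "'a set" and A B :: "'a \<Rightarrow> 'a set"
  assumes "finite V"
    and "\<And>v. v \<in> V \<Longrightarrow> finite (A v) \<and> finite (B v) \<and> v \<in> A v \<and> v \<in> B v \<and> card (A v) \<le> k"
    and "\<And>v w. v \<in> V \<Longrightarrow> w \<in> V \<Longrightarrow> \<exists>x. A v \<inter> B w = {x}"
  shows "(\<Sum>v\<in>V. (1/2 :: real) ^ card (B v)) \<le> (2 ^ k - 1) / 2"
  using assms
proof (induction k arbitrary: V A B)
  case 0
  have "V = {}"
  proof (rule ccontr)
    assume "V \<noteq> {}"
    then obtain v where "v \<in> V" by blast
    with "0.prems"(2)[of v] show False by auto
  qed
  then show ?case by simp
next
  case (Suc k)
  show ?case
  proof (cases "V = {}")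
    case False
    obtain h where h: "h \<in> V" and hmin: "\<And>v. v \<in> V \<Longrightarrow> card (B h) \<le> card (B v)"
      using ex_is_arg_min_if_finite[OF Suc.prems(1) False, of "\<lambda>v. card (B v)"]
      unfolding is_arg_min_linorder by blast
    define H where "H = B h"
    have finH: "finite H" using Suc.prems(2)[OF h] by (simp add: H_def)
    \<comment> \<open>\<open>R\<close> stands for the set of red vertices of \<open>H\<close>; the
      rest of \<open>H\<close> is blue.\<close>
    define surv where
      "surv = (\<lambda>R. {v \<in> V - H. A v \<inter> H \<subseteq> R \<and> B v \<inter> R = {}})"
    have lost: "(\<Sum>v\<in>V \<inter> H. (1/2 :: real) ^ card (B v)) \<le> 1/2"
    proof -
      have "(\<Sum>v\<in>V \<inter> H. (1/2 :: real) ^ card (B v)) \<le> card (V \<inter> H) * (1/2) ^ card H"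
        by (rule sum_bounded_above, rule power_decreasing) (simp_all add: H_def hmin)
      also have "\<dots> \<le> card H * (1/2) ^ card H"
        by (rule mult_right_mono) (simp_all add: card_mono finH)
      also have "\<dots> \<le> 1/2"
      proof -
        have "real (2 * card H) \<le> real (2 ^ card H)"
          using two_mult_le_power_two by (rule of_nat_mono)
        then show ?thesis by (simp add: power_one_over field_simps)
      qed
      finally show ?thesis .
    qed
    have kept: "(\<Sum>R\<in>{R \<in> Pow H. v \<in> surv R}. (1/2 :: real) ^ card (B v - H))
        = 2 ^ card H / 2 * (1/2) ^ card (B v)" if v: "v \<in> V - H" for v
    proof -
      \<comment> \<open>The only vertex \<open>x\<close> of \<open>A v\<close> in \<open>H\<close>
        has to be red. It cannot lie in \<open>B v\<close>, since \<open>A v\<close> and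
        \<open>B v\<close> share only \<open>v\<close>, which is outside \<open>H\<close>.\<close>
      obtain x where x: "A v \<inter> H = {x}"
        using Suc.prems(3)[of v h] v h unfolding H_def by blast
      obtain y where "A v \<inter> B v = {y}" using Suc.prems(3)[of v v] v by blast
      moreover have "v \<in> A v \<inter> B v" using Suc.prems(2)[of v] v by blast
      ultimately have "A v \<inter> B v = {v}" by (metis singletonD)
      moreover have xA: "x \<in> A v" "x \<in> H" using x by auto
      ultimately have xB: "x \<notin> B v" using v by (metis DiffD2 IntI singletonD)
      have finB: "finite (B v)" using Suc.prems(2)[of v] v by simp
      have "{R \<in> Pow H. v \<in> surv R} = {R \<in> Pow H. x \<in> R \<and> B v \<inter> R = {}}"
        using v x by (simp add: surv_def)
      then have card_surv: "card {R \<in> Pow H. v \<in> surv R} = 2 ^ (card H - 1 - card (B v \<inter> H))"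
        using card_subsets_between[OF finH xA(2) xB] by simp
      \<comment> \<open>Strict because of \<open>x\<close>, so the truncated subtraction in the
        exponent is a true one, with value \<open>d\<close>.\<close>
      have "card (B v \<inter> H) < card H"
        using xA xB finH by (intro psubset_card_mono) auto
      then obtain d where d: "card H = Suc (card (B v \<inter> H) + d)"
        using less_imp_Suc_add by blast
      have "card (B v) = card (B v \<inter> H) + card (B v - H)"
        using finB by (metis card_Int_Diff)
      with card_surv d show ?thesis
        by (simp add: power_add power_divide)
    qed
    have step: "(\<Sum>v\<in>surv R. (1/2 :: real) ^ card (B v - H)) \<le> (2 ^ k - 1) / 2" for R
    proof (rule Suc.IH[where A = "\<lambda>v. A v - H"])
      show "finite (surv R)" using Suc.prems(1) by (simp add: surv_def)
    next
      fix v assume v: "v \<in> surv R"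
      then have vV: "v \<in> V" "v \<notin> H" by (auto simp: surv_def)
      obtain x where x: "A v \<inter> H = {x}"
        using Suc.prems(3)[OF vV(1) h] unfolding H_def by blast
      have "card (A v) = card (A v \<inter> H) + card (A v - H)"
        using Suc.prems(2)[OF vV(1)] by (metis card_Int_Diff)
      with x Suc.prems(2)[OF vV(1)] vV
      show "finite (A v - H) \<and> finite (B v - H) \<and> v \<in> A v - H \<and> v \<in> B v - H \<and> card (A v - H) \<le> k"
        by simp
    next
      fix v w assume vw: "v \<in> surv R" "w \<in> surv R"
      then obtain x where x: "A v \<inter> B w = {x}"
        using Suc.prems(3)[of v w] unfolding surv_def by blast
      then have "x \<in> A v" "x \<in> B w" by auto
      \<comment> \<open>A vertex of \<open>H\<close> in \<open>A v\<close> would be red, one in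
        \<open>B w\<close> would not.\<close>
      with vw have "x \<notin> H" by (auto simp: surv_def)
      moreover have "(A v - H) \<inter> (B w - H) = A v \<inter> B w - H" by blast
      ultimately show "\<exists>x. (A v - H) \<inter> (B w - H) = {x}" using x by (simp add: insert_Diff_if)
    qed
    \<comment> \<open>The expectation is written as a sum over all \<open>2 ^ card H\<close>
      colourings, and the order of summation is exchanged.\<close>
    have "2 ^ card H / 2 * (\<Sum>v\<in>V - H. (1/2 :: real) ^ card (B v))
        = (\<Sum>v\<in>V - H. \<Sum>R\<in>{R \<in> Pow H. v \<in> surv R}. (1/2) ^ card (B v - H))"
      unfolding sum_distrib_left by (rule sum.cong[OF refl]) (rule kept[symmetric])
    also have "\<dots> = (\<Sum>R\<in>Pow H. \<Sum>v\<in>{v \<in> V - H. v \<in> surv R}. (1/2) ^ card (B v - H))"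
      using Suc.prems(1) finH by (intro sum.swap_restrict) auto
    also have "\<dots> = (\<Sum>R\<in>Pow H. \<Sum>v\<in>surv R. (1/2) ^ card (B v - H))"
      by (intro sum.cong refl) (auto simp: surv_def)
    also have "\<dots> \<le> card (Pow H) * ((2 ^ k - 1) / 2)"
      by (intro sum_bounded_above step)
    finally have "2 ^ card H * (\<Sum>v\<in>V - H. (1/2 :: real) ^ card (B v))
        \<le> 2 ^ card H * (2 ^ k - 1)"
      using finH by (simp add: card_Pow)
    then have "(\<Sum>v\<in>V - H. (1/2 :: real) ^ card (B v)) \<le> 2 ^ k - 1"
      by (rule mult_left_le_imp_le) simp
    moreover have "(\<Sum>v\<in>V. (1/2 :: real) ^ card (B v))
        = (\<Sum>v\<in>V \<inter> H. (1/2) ^ card (B v)) + (\<Sum>v\<in>V - H. (1/2) ^ card (B v))"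
      using Suc.prems(1) by (rule sum.Int_Diff)
    ultimately show ?thesis using lost by (simp add: field_simps)
  next
    case True
    then show ?thesis using one_le_power[of "2 :: real" "Suc k"] by simp
  qed
qed

lemma clique_indep_Int_le_one:
  assumes "clique K E" "indep S E" "x \<in> K \<inter> S" "y \<in> K \<inter> S"
  shows "x = y"
  using assms by (auto simp: clique_def indep_def)

lemma cs_normal_card_le:
  assumes "finite V" "cs_normal c s V E"
  shows "card V \<le> 2 ^ (c + s)"
proof -
  from assms(2) obtain \<C> \<S> where "cs_normal_cover c s V E \<C> \<S>"
    by (auto simp: cs_normal_def)
  then have
      C: "\<And>K. K \<in> \<C> \<Longrightarrow> clique K E \<and> finite K \<and> card K \<le> c" and
      S: "\<And>S. S \<in> \<S> \<Longrightarrow> indep S E \<and> finite S \<and> card S \<le> s" and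
      UC: "\<Union>\<C> = V" and US: "\<Union>\<S> = V" and
      meet: "\<And>K S. K \<in> \<C> \<Longrightarrow> S \<in> \<S> \<Longrightarrow> K \<inter> S \<noteq> {}"
    unfolding cs_normal_cover_def normal_cover_def by simp_all
  have "\<forall>v\<in>V. \<exists>K. K \<in> \<C> \<and> v \<in> K" using UC by blast
  from bchoice[OF this] obtain A where A: "\<And>v. v \<in> V \<Longrightarrow> A v \<in> \<C> \<and> v \<in> A v"
    by metis
  have "\<forall>v\<in>V. \<exists>S. S \<in> \<S> \<and> v \<in> S" using US by blast
  from bchoice[OF this] obtain B where B: "\<And>v. v \<in> V \<Longrightarrow> B v \<in> \<S> \<and> v \<in> B v"
    by metis
  \<comment> \<open>Each vertex weighs at least \<open>(1/2) ^ s\<close>, so a bound on the total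
    weight bounds the number of vertices.\<close>
  have "card V * (1/2 :: real) ^ s = (\<Sum>v\<in>V. (1/2 :: real) ^ s)" by simp
  also have "\<dots> \<le> (\<Sum>v\<in>V. (1/2 :: real) ^ card (B v))"
  proof (intro sum_mono power_decreasing)
    show "card (B v) \<le> s" if "v \<in> V" for v using B[OF that] S[of "B v"] by blast
  qed auto
  also have "\<dots> \<le> (2 ^ c - 1) / 2"
  proof (rule cross_intersecting_weight_le[where A = A])
    show "finite V" by fact
  next
    fix v assume "v \<in> V"
    then have "A v \<in> \<C>" "v \<in> A v" "B v \<in> \<S>" "v \<in> B v" using A B by auto
    then show "finite (A v) \<and> finite (B v) \<and> v \<in> A v \<and> v \<in> B v \<and> card (A v) \<le> c"
      using C[of "A v"] S[of "B v"] by simp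
  next
    fix v w assume "v \<in> V" "w \<in> V"
    then have AB: "A v \<in> \<C>" "B w \<in> \<S>" using A B by auto
    then obtain x where x: "x \<in> A v \<inter> B w" using meet by blast
    then have "A v \<inter> B w = {x}"
      using clique_indep_Int_le_one[of "A v" E "B w"] C[OF AB(1)] S[OF AB(2)] by blast
    then show "\<exists>x. A v \<inter> B w = {x}" ..
  qed
  also have "\<dots> \<le> 2 ^ c" by (simp add: field_simps)
  finally have "real (card V) \<le> real (2 ^ (c + s))"
    by (simp add: power_divide power_add field_simps)
  then show ?thesis by (simp only: of_nat_le_iff)
qed

theorem theorem1:
  fixes c s :: nat
  assumes "c > 0" and "s > 0"
  shows "(\<forall>(V :: 'a set) E. finite_simple_graph V E \<and> cs_normal c s V E \<longrightarrow> card V \<le> 2 ^ (c + s))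
         \<and> max_cs_normal c s \<le> 2 ^ (c + s)"
proof
  show "\<forall>(V :: 'a set) E. finite_simple_graph V E \<and> cs_normal c s V E \<longrightarrow> card V \<le> 2 ^ (c + s)"
    by (auto simp: finite_simple_graph_def intro: cs_normal_card_le)
  have bound: "cs_normal_orders c s \<subseteq> {..2 ^ (c + s)}"
    by (auto simp: cs_normal_orders_def finite_simple_graph_def intro: cs_normal_card_le)
  \<comment> \<open>\<open>Max\<close> is meaningful for finite nonempty sets: the bound gives
    finiteness, the empty graph gives an element.\<close>
  then have "Max (cs_normal_orders c s) \<in> cs_normal_orders c s"
    using zero_in_cs_normal_orders[of c s] by (intro Max_in) (auto intro: finite_subset)
  with bound show "max_cs_normal c s \<le> 2 ^ (c + s)"
    by (auto simp: max_cs_normal_def)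
qed

end
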